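(* Let $k=\lceil m/2\rceil$ and let $[\alpha_1\cdots\alpha_k]^T$ be the solution to the matrix equation $$[C^*_m(1)\ \cdots\ C^*_m(k)]\,[\alpha_1\cdots\alpha_k]^T=[C^*_m(k+1)]$$ inside the $m\times\infty$ table. Then $$\mathcal{C}(n+k,i)=\alpha_1\mathcal{C}(n,i)+\cdots+\alpha_k\mathcal{C}(n+k-1,i)\qquad(1)$$ for all $1\leq i\leq m$ and $n\geq1$. As a result, $$\mathcal{I}_m(n+k)=\alpha_1\mathcal{I}_m(n)+\cdots+\alpha_k\mathcal{I}_m(n+k-1)\qquad(2)$$ for all $n\geq1$. Moreover, these recurrence relations are of the minimum degree $k$, that is, all other recurrence relations for columns entries and columns sums can be derived from these recurrence relations.
   Context: For an integer $m\geq1$, the $m\times\infty$ table has cells $(x,y)$ with column index $x\geq1$ and row index $1\leq y\leq m$. A lattice path in the table is a sequence $\nu_1,\ldots,\nu_r$ of cells with $\nu_{j+1}-\nu_j\in\{(1,-1),(1,0),(1,1)\}$ for all $j=1,\ldots,r-1$. $\mathcal{C}(x,y)=\mathcal{C}_m(x,y)$ denotes the number of lattice paths from the first column to the cell $(x,y)$. Thus $\mathcal{C}(1,y)=1$ for $1\leq y\leq m$ and, with the convention $\mathcal{C}(x,0)=\mathcal{C}(x,m+1)=0$, $\mathcal{C}(x+1,y)=\mathcal{C}(x,y-1)+\mathcal{C}(x,y)+\mathcal{C}(x,y+1)$ for all $x\geq1$ and $1\leq y\leq m$. The columns entries are the numbers $\mathcal{C}(n,i)$, and the $n$th column sum is $\mathcal{I}_m(n)=\mathcal{C}(n,1)+\cdots+\mathcal{C}(n,m)$,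 the number of lattice paths from the first column to the $n$th column. The reduced $n$th column $C^*_m(n)$ is the column vector consisting of the entries of the $n$th column in the rows $1,\ldots,\lceil m/2\rceil$, that is, $C^*_m(n)=[\mathcal{C}(n,1),\ldots,\mathcal{C}(n,\lceil m/2\rceil)]^T$; $[C^*_m(1)\ \cdots\ C^*_m(k)]$ is the matrix with these columns. The degree of a linear recurrence relation $a(n+d)=\beta_0a(n)+\cdots+\beta_{d-1}a(n+d-1)$ satisfied by a sequence $\{a(n)\}$ is the number $d$, provided that $\beta_0\neq0$. *)

theory Defs
  imports Complex_Main "HOL-Library.Product_Plus" "Jordan_Normal_Form.Matrix"
begin

text \<open>A cell is a pair (column index, row index).\<close>

definition table :: "nat \<Rightarrow> (int \<times> int) set" where
  "table m = {(x, y). 1 \<le> x \<and> 1 \<le> y \<and> y \<le> int m}"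

definition lattice_path :: "nat \<Rightarrow> (int \<times> int) list \<Rightarrow> bool" where
  "lattice_path m p \<longleftrightarrow> p \<noteq> [] \<and> set p \<subseteq> table m \<and>
     (\<forall>j. Suc j < length p \<longrightarrow> p ! Suc j - p ! j \<in> {(1, -1), (1, 0), (1, 1)})"

definition entry :: "nat \<Rightarrow> nat \<Rightarrow> nat \<Rightarrow> nat" where
  "entry m x y =
     card {p. lattice_path m p \<and> fst (hd p) = 1 \<and> last p = (int x, int y)}"

definition column_sum :: "nat \<Rightarrow> nat \<Rightarrow> nat" where
  "column_sum m n = (\<Sum>i = 1..m. entry m n i)"

text \<open>Vectors are indexed from 0, so position \<open>i\<close> holds the entry in row \<open>i + 1\<close>.\<close>

definition reduced_column :: "nat \<Rightarrow> nat \<Rightarrow> real vec" where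
  "reduced_column m n = vec (nat \<lceil>real m / 2\<rceil>) (\<lambda>i. real (entry m n (i + 1)))"

definition reduced_matrix :: "nat \<Rightarrow> nat \<Rightarrow> real mat" where
  "reduced_matrix m k =
     mat_of_cols (nat \<lceil>real m / 2\<rceil>) (map (reduced_column m) [1..<k + 1])"

text \<open>
  A vector \<open>\<beta>\<close> of dimension \<open>d\<close> encodes the recurrence relation
  \<open>a (n + d) = \<beta>\<^sub>0 a n + \<dots> + \<beta>\<^sub>d\<^sub>-\<^sub>1 a (n + d - 1)\<close>. Sequences are indexed from 1;
  the value at 0 is never used.
\<close>

definition rec_defect :: "real vec \<Rightarrow> (nat \<Rightarrow> real) \<Rightarrow> nat \<Rightarrow> real" where
  "rec_defect \<beta> a n = a (n + dim_vec \<beta>) - (\<Sum>j<dim_vec \<beta>. \<beta> $ j * a (n + j))"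

definition satisfies_rec :: "real vec \<Rightarrow> (nat \<Rightarrow> real) \<Rightarrow> bool" where
  "satisfies_rec \<beta> a \<longleftrightarrow>
     (\<forall>n\<ge>1. a (n + dim_vec \<beta>) = (\<Sum>j<dim_vec \<beta>. \<beta> $ j * a (n + j)))"

definition has_degree :: "real vec \<Rightarrow> nat \<Rightarrow> bool" where
  "has_degree \<beta> d \<longleftrightarrow> dim_vec \<beta> = d \<and> 1 \<le> d \<and> \<beta> $ 0 \<noteq> 0"

text \<open>
  The relation \<open>\<beta>\<close> is derived from \<open>\<alpha>\<close> if it is a linear combination of shifts of \<open>\<alpha>\<close>,
  as a formal identity: the coefficients \<open>c\<close> depend neither on the sequence nor on \<open>n\<close>.
\<close>

definition derived_from :: "real vec \<Rightarrow> real vec \<Rightarrow> bool" where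
  "derived_from \<alpha> \<beta> \<longleftrightarrow>
     (\<exists>N c. \<forall>a. \<forall>n\<ge>1. rec_defect \<beta> a n = (\<Sum>s<N. c s * rec_defect \<alpha> a (n + s)))"

text \<open>
  A recurrence relation for the column entries is one relation valid in all rows
  simultaneously. Single rows may satisfy shorter relations: for \<open>m = 5\<close>, row 2 satisfies
  \<open>a (n + 2) = 2 a n + 2 a (n + 1)\<close>.
\<close>

definition entries_rec :: "nat \<Rightarrow> real vec \<Rightarrow> bool" where
  "entries_rec m \<beta> \<longleftrightarrow> (\<forall>i\<in>{1..m}. satisfies_rec \<beta> (\<lambda>n. real (entry m n i)))"

definition sums_rec :: "nat \<Rightarrow> real vec \<Rightarrow> bool" where
  "sums_rec m \<beta> \<longleftrightarrow> satisfies_rec \<beta> (\<lambda>n. real (column_sum m n))"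

end

theory Submission
  imports Defs "Jordan_Normal_Form.Determinant" "HOL-Computational_Algebra.Polynomial"
begin

text \<open>
  Let \<open>A\<close> be the tridiagonal matrix of ones of size \<open>m\<close>, so that the columns of the table are
  \<open>C\<^sub>n = A\<^sup>n\<^sup>-\<^sup>1 \<one>\<close> with \<open>\<one>\<close> the all-ones vector. Recurrence relations are encoded by polynomials \<open>P\<close>
  acting on sequences through the shift; one holds for all rows iff \<open>P(A) \<one> = 0\<close>.

  The vectors \<open>v(y) = sin (\<theta> y)\<close> with \<open>\<theta> = (2 j + 1) \<pi> / (m + 1)\<close>, \<open>j < k\<close>, are eigenvectors of the
  symmetric matrix \<open>A\<close>, with pairwise distinct eigenvalues \<open>\<lambda> = 1 + 2 cos \<theta>\<close>. Summing the
  eigenvalue equation over all rows gives \<open>(3 - \<lambda>) \<langle>v, \<one>\<rangle> = 2 v(1) > 0\<close>, so \<open>\<langle>v, \<one>\<rangle> \<noteq> 0\<close>.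
  Pairing \<open>P(A) \<one> = 0\<close> with \<open>v\<close> yields \<open>P(\<lambda>) \<langle>v, \<one>\<rangle> = 0\<close>: every annihilating polynomial
  vanishes at all \<open>k\<close> eigenvalues (\<open>annihilates_imp_root\<close>).

  Since the columns are symmetric under \<open>y \<mapsto> m + 1 - y\<close>, a polynomial annihilates \<open>\<one>\<close> as soon as it
  does so in the rows \<open>1, \<dots>, k\<close>. Hence a kernel vector of the reduced matrix is the coefficient vector of an
  annihilating polynomial of degree below \<open>k\<close>, which has \<open>k\<close> roots and is zero; so the reduced system has
  exactly one solution \<open>\<alpha>\<close>, and its monic polynomial of degree \<open>k\<close> annihilates \<open>\<one>\<close>. It has exactly
  the roots \<open>\<lambda>\<close>; none is zero, because \<open>cos \<theta> = - 1/2\<close> would mean \<open>3 (2 j + 1) = 2 (m + 1)\<close>, so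
  \<open>\<alpha>\<^sub>0 \<noteq> 0\<close>. Every other annihilating polynomial vanishes at the same \<open>k\<close> points and is therefore a multiple
  of it, which is derivability.

  Column sums reduce to column entries (\<open>sums_annihilated_imp_annihilates\<close>): symmetry of \<open>A\<close> gives
  \<open>\<langle>C\<^sub>p, C\<^sub>q\<rangle> = I(p + q - 1)\<close>, so if \<open>P\<close> annihilates the column sums then \<open>P(A) \<one>\<close> is orthogonal to all
  columns, hence to itself, and vanishes.
\<close>

section \<open>The recurrence for the table entries\<close>

text \<open>The lattice paths from the first column to the cell \<open>c\<close>; there are none if \<open>c\<close> is not in the table.\<close>

definition paths_to :: "nat \<Rightarrow> int \<times> int \<Rightarrow> (int \<times> int) list set" where
  "paths_to m c = {p. lattice_path m p \<and> fst (hd p) = 1 \<and> last p = c}"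

lemma entry_eq_card: "entry m x y = card (paths_to m (int x, int y))"
  unfolding entry_def paths_to_def by (rule refl)

lemma lattice_path_snoc:
  assumes "q \<noteq> []"
  shows "lattice_path m (q @ [c]) \<longleftrightarrow>
    lattice_path m q \<and> c \<in> table m \<and> c - last q \<in> {(1, -1), (1, 0), (1, 1)}"
proof -
  have steps: "(\<forall>j. Suc j < length (q @ [c]) \<longrightarrow> (q @ [c]) ! Suc j - (q @ [c]) ! j \<in> S) \<longleftrightarrow>
    (\<forall>j. Suc j < length q \<longrightarrow> q ! Suc j - q ! j \<in> S) \<and> c - last q \<in> S" (is "?L \<longleftrightarrow> ?R") for S
  proof
    assume L: ?L
    have "q ! Suc j - q ! j \<in> S" if "Suc j < length q" for j
      using L[rule_format, of j] that by (simp add: nth_append)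
    moreover have "c - last q \<in> S"
      using L[rule_format, of "length q - 1"] assms by (simp add: nth_append last_conv_nth)
    ultimately show ?R by blast
  next
    assume R: ?R
    show ?L
    proof (intro allI impI)
      fix j assume "Suc j < length (q @ [c])"
      then consider "Suc j < length q" | "Suc j = length q" by fastforce
      then show "(q @ [c]) ! Suc j - (q @ [c]) ! j \<in> S"
      proof cases
        case 1
        then show ?thesis using R by (simp add: nth_append)
      next
        case 2
        then have "j = length q - 1" by simp
        then show ?thesis using R 2 assms by (simp add: nth_append last_conv_nth)
      qed
    qed
  qed
  have "set (q @ [c]) \<subseteq> table m \<longleftrightarrow> set q \<subseteq> table m \<and> c \<in> table m" by auto
  then show ?thesis
    using assms unfolding lattice_path_def steps by blast
qed

lemma paths_to_outside: "c \<notin> table m \<Longrightarrow> paths_to m c = {}"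
  unfolding paths_to_def lattice_path_def by (auto dest: last_in_set)

lemma paths_to_step:
  assumes "(x, y) \<in> table m" "x \<noteq> 1"
  shows "paths_to m (x, y) = (\<lambda>q. q @ [(x, y)]) `
    (paths_to m (x - 1, y - 1) \<union> paths_to m (x - 1, y) \<union> paths_to m (x - 1, y + 1))"
    (is "_ = ?f ` ?U")
proof (intro Set.set_eqI iffI)
  fix p assume p: "p \<in> paths_to m (x, y)"
  then have "p \<noteq> []" and l: "last p = (x, y)"
    by (auto simp: paths_to_def lattice_path_def)
  then obtain q where q: "p = q @ [(x, y)]"
    by (metis append_butlast_last_id)
  have "q \<noteq> []" using p q assms by (auto simp: paths_to_def)
  obtain a b where ab: "last q = (a, b)" by fastforce
  have "lattice_path m q" "(x, y) - last q \<in> {(1, -1), (1, 0), (1, 1)}" "fst (hd q) = 1"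
    using p q \<open>q \<noteq> []\<close> lattice_path_snoc[OF \<open>q \<noteq> []\<close>] by (auto simp: paths_to_def)
  moreover from this ab have "last q \<in> {(x - 1, y - 1), (x - 1, y), (x - 1, y + 1)}" by auto
  ultimately have "q \<in> ?U" by (auto simp: paths_to_def)
  then show "p \<in> ?f ` ?U" using q by blast
next
  fix p assume "p \<in> ?f ` ?U"
  then obtain q where q: "q \<in> ?U" "p = q @ [(x, y)]" by blast
  then have "q \<noteq> []" by (auto simp: paths_to_def lattice_path_def)
  then show "p \<in> paths_to m (x, y)"
    using q assms lattice_path_snoc[OF \<open>q \<noteq> []\<close>] by (auto simp: paths_to_def)
qed

lemma paths_to_first_column:
  assumes "(1, y) \<in> table m"
  shows "paths_to m (1, y) = {[(1, y)]}"
proof (intro Set.set_eqI iffI)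
  fix p assume p: "p \<in> paths_to m (1, y)"
  then have "p \<noteq> []" and l: "last p = (1, y)"
    by (auto simp: paths_to_def lattice_path_def)
  then obtain q where q: "p = q @ [(1, y)]"
    by (metis append_butlast_last_id)
  have "q = []"
  proof (rule ccontr)
    assume "q \<noteq> []"
    obtain a b where ab: "last q = (a, b)" by fastforce
    have "last q \<in> table m" "(1, y) - last q \<in> {(1, -1), (1, 0), (1, 1)}"
      using p q \<open>q \<noteq> []\<close> lattice_path_snoc[OF \<open>q \<noteq> []\<close>]
      by (auto simp: paths_to_def lattice_path_def)
    then show False using ab by (auto simp: table_def)
  qed
  then show "p \<in> {[(1, y)]}" using q by simp
qed (use assms in \<open>auto simp: paths_to_def lattice_path_def\<close>)

lemma finite_paths_to: "finite (paths_to m (int x, y))"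
proof (induction x arbitrary: y)
  case 0
  then show ?case by (simp add: paths_to_outside table_def)
next
  case (Suc x)
  show ?case
  proof (cases "(int (Suc x), y) \<in> table m")
    case True
    show ?thesis
    proof (cases "x = 0")
      case True
      then show ?thesis using \<open>_ \<in> table m\<close> paths_to_first_column[of y m] by simp
    next
      case False
      then show ?thesis using paths_to_step[OF True] Suc by simp
    qed
  qed (simp add: paths_to_outside)
qed

lemma entry_outside: "y = 0 \<or> y > m \<Longrightarrow> entry m x y = 0"
  by (auto simp: entry_eq_card paths_to_outside table_def)

lemma entry_first_column: "1 \<le> y \<Longrightarrow> y \<le> m \<Longrightarrow> entry m 1 y = 1"
  using paths_to_first_column[of "int y" m] by (simp add: entry_eq_card table_def)

lemma entry_Suc:
  assumes "1 \<le> x" "1 \<le> y" "y \<le> m"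
  shows "entry m (Suc x) y = entry m x (y - 1) + entry m x y + entry m x (y + 1)"
proof -
  let ?A = "paths_to m (int x, int (y - 1))" and ?B = "paths_to m (int x, int y)"
    and ?C = "paths_to m (int x, int (y + 1))"
  have "int (Suc x) - 1 = int x" "int y - 1 = int (y - 1)" "int y + 1 = int (y + 1)"
    using assms by auto
  moreover have "(int (Suc x), int y) \<in> table m" "int (Suc x) \<noteq> 1"
    using assms by (auto simp: table_def)
  ultimately have "paths_to m (int (Suc x), int y) = (\<lambda>q. q @ [(int (Suc x), int y)]) ` (?A \<union> ?B \<union> ?C)"
    using paths_to_step[of "int (Suc x)" "int y" m] by metis
  moreover have "card ((\<lambda>q. q @ [(int (Suc x), int y)]) ` (?A \<union> ?B \<union> ?C)) = card (?A \<union> ?B \<union> ?C)"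
    by (rule card_image) (simp add: inj_on_def)
  moreover have "card (?A \<union> ?B \<union> ?C) = card (?A \<union> ?B) + card ?C"
    by (rule card_Un_disjoint) (use assms in \<open>auto simp: finite_paths_to\<close>, use assms in \<open>auto simp: paths_to_def\<close>)
  moreover have "card (?A \<union> ?B) = card ?A + card ?B"
    by (rule card_Un_disjoint) (use assms in \<open>auto simp: finite_paths_to\<close>, use assms in \<open>auto simp: paths_to_def\<close>)
  ultimately show ?thesis by (simp only: entry_eq_card)
qed

lemma entry_symmetric:
  assumes "1 \<le> x" "y \<le> m + 1"
  shows "entry m x (m + 1 - y) = entry m x y"
  using assms
proof (induction x arbitrary: y rule: nat_induct_at_least)
  case base
  show ?case
  proof (cases "y = 0 \<or> y = m + 1")
    case True
    then show ?thesis by (auto simp: entry_outside)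
  next
    case False
    then have "1 \<le> y" "y \<le> m" "1 \<le> m + 1 - y" "m + 1 - y \<le> m" using base by auto
    then show ?thesis by (simp only: entry_first_column)
  qed
next
  case (Suc x)
  show ?case
  proof (cases "y = 0 \<or> y = m + 1")
    case True
    then show ?thesis by (auto simp: entry_outside)
  next
    case False
    then have y: "1 \<le> y" "y \<le> m" using Suc.prems by auto
    have "m + 1 - y - 1 = m + 1 - (y + 1)" "m + 1 - y + 1 = m + 1 - (y - 1)" using y by auto
    moreover have "entry m x (m + 1 - (y + 1)) = entry m x (y + 1)"
      "entry m x (m + 1 - (y - 1)) = entry m x (y - 1)" "entry m x (m + 1 - y) = entry m x y"
      using y by (intro Suc.IH; linarith)+
    moreover have "entry m (Suc x) (m + 1 - y) =
        entry m x (m + 1 - y - 1) + entry m x (m + 1 - y) + entry m x (m + 1 - y + 1)"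
      using y by (intro entry_Suc[OF Suc.hyps]) auto
    ultimately show ?thesis using entry_Suc[OF Suc.hyps y] by presburger
  qed
qed

section \<open>Recurrence relations as polynomials in the shift\<close>

text \<open>
  The value at \<open>n\<close> of the sequence obtained from \<open>a\<close> by applying the polynomial \<open>P\<close> in the shift
  operator \<open>a \<mapsto> (\<lambda>n. a (n + 1))\<close>.
\<close>

definition shift_eval :: "real poly \<Rightarrow> (nat \<Rightarrow> real) \<Rightarrow> nat \<Rightarrow> real" where
  "shift_eval P a n = (\<Sum>i\<le>degree P. coeff P i * a (n + i))"

lemma shift_eval_bound:
  assumes "degree P \<le> N"
  shows "shift_eval P a n = (\<Sum>i\<le>N. coeff P i * a (n + i))"
  unfolding shift_eval_def
  by (rule sum.mono_neutral_left) (use assms in \<open>auto simp: coeff_eq_0\<close>)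

lemma shift_eval_0 [simp]: "shift_eval 0 a n = 0"
  by (simp add: shift_eval_def)

lemma shift_eval_add: "shift_eval (P + Q) a n = shift_eval P a n + shift_eval Q a n"
proof -
  let ?N = "max (degree P) (degree Q)"
  have "degree (P + Q) \<le> ?N" "degree P \<le> ?N" "degree Q \<le> ?N"
    by (auto intro: degree_add_le_max)
  then show ?thesis
    by (simp add: shift_eval_bound[of _ ?N] sum.distrib algebra_simps)
qed

lemma shift_eval_smult: "shift_eval (smult c P) a n = c * shift_eval P a n"
  by (cases "c = 0") (simp_all add: shift_eval_def sum_distrib_left mult.assoc)

lemma shift_eval_pCons: "shift_eval (pCons c P) a n = c * a n + shift_eval P a (Suc n)"
proof -
  have "shift_eval (pCons c P) a n = (\<Sum>i\<le>Suc (degree P). coeff (pCons c P) i * a (n + i))"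
    by (rule shift_eval_bound) (rule degree_pCons_le)
  also have "\<dots> = c * a n + (\<Sum>i\<le>degree P. coeff P i * a (Suc n + i))"
    by (subst sum.atMost_Suc_shift) simp
  finally show ?thesis by (simp add: shift_eval_def)
qed

text \<open>Multiplication of polynomials is composition of the corresponding operators.\<close>

lemma shift_eval_mult: "shift_eval (Q * P) a n = shift_eval Q (shift_eval P a) n"
proof (induction Q arbitrary: n)
  case (pCons c Q)
  then show ?case
    by (simp add: shift_eval_add shift_eval_smult shift_eval_pCons)
qed simp

lemma shift_eval_sum:
  "shift_eval P (\<lambda>n. \<Sum>y\<in>S. w y * f n y) n = (\<Sum>y\<in>S. w y * shift_eval P (\<lambda>n. f n y) n)"
proof -
  have "shift_eval P (\<lambda>n. \<Sum>y\<in>S. w y * f n y) n =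
      (\<Sum>i\<le>degree P. \<Sum>y\<in>S. w y * (coeff P i * f (n + i) y))"
    by (simp add: shift_eval_def sum_distrib_left mult.left_commute)
  also have "\<dots> = (\<Sum>y\<in>S. \<Sum>i\<le>degree P. w y * (coeff P i * f (n + i) y))"
    by (rule sum.swap)
  finally show ?thesis by (simp add: shift_eval_def sum_distrib_left)
qed

text \<open>The polynomial with coefficient vector \<open>w\<close>.\<close>

definition vec_poly :: "real vec \<Rightarrow> real poly" where
  "vec_poly w = (\<Sum>j<dim_vec w. monom (w $ j) j)"

text \<open>The monic polynomial of degree \<open>dim_vec \<beta>\<close> encoding the recurrence relation \<open>\<beta>\<close>.\<close>

definition rec_poly :: "real vec \<Rightarrow> real poly" where
  "rec_poly \<beta> = monom 1 (dim_vec \<beta>) - vec_poly \<beta>"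

lemma coeff_vec_poly: "coeff (vec_poly w) i = (if i < dim_vec w then w $ i else 0)"
  by (simp add: vec_poly_def coeff_sum)

lemma coeff_rec_poly:
  "coeff (rec_poly \<beta>) i = (if i < dim_vec \<beta> then - \<beta> $ i else if i = dim_vec \<beta> then 1 else 0)"
  by (auto simp: rec_poly_def coeff_vec_poly)

lemma degree_rec_poly: "degree (rec_poly \<beta>) = dim_vec \<beta>"
  by (rule antisym, rule degree_le, simp add: coeff_rec_poly, rule le_degree, simp add: coeff_rec_poly)

lemma rec_poly_nonzero: "rec_poly \<beta> \<noteq> 0"
  using coeff_rec_poly[of \<beta> "dim_vec \<beta>"] by auto

lemma rec_defect_eq_shift_eval: "rec_defect \<beta> a n = shift_eval (rec_poly \<beta>) a n"
proof -
  have "shift_eval (rec_poly \<beta>) a n =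
      (\<Sum>i<dim_vec \<beta>. coeff (rec_poly \<beta>) i * a (n + i)) + a (n + dim_vec \<beta>)"
    by (simp add: shift_eval_def degree_rec_poly coeff_rec_poly flip: lessThan_Suc_atMost)
  also have "(\<Sum>i<dim_vec \<beta>. coeff (rec_poly \<beta>) i * a (n + i)) = (\<Sum>i<dim_vec \<beta>. - (\<beta> $ i * a (n + i)))"
    by (rule sum.cong) (auto simp: coeff_rec_poly)
  finally show ?thesis by (simp add: rec_defect_def sum_negf)
qed

lemma satisfies_rec_iff: "satisfies_rec \<beta> a \<longleftrightarrow> (\<forall>n\<ge>1. shift_eval (rec_poly \<beta>) a n = 0)"
  by (simp add: satisfies_rec_def rec_defect_def flip: rec_defect_eq_shift_eval)

lemma dvd_imp_derived_from:
  assumes "rec_poly \<alpha> dvd rec_poly \<beta>"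
  shows "derived_from \<alpha> \<beta>"
proof -
  obtain Q where Q: "rec_poly \<beta> = Q * rec_poly \<alpha>"
    using assms by (metis dvdE mult.commute)
  have "rec_defect \<beta> a n = (\<Sum>s<Suc (degree Q). coeff Q s * rec_defect \<alpha> a (n + s))" for a n
    by (simp only: rec_defect_eq_shift_eval Q shift_eval_mult lessThan_Suc_atMost)
      (simp only: shift_eval_def[of Q])
  then show ?thesis unfolding derived_from_def by blast
qed

section \<open>The tridiagonal operator and its eigenvectors\<close>

lemma sum_neighbours:
  fixes f :: "nat \<Rightarrow> real"
  assumes "f 0 = 0" "f (m + 1) = 0"
  shows "(\<Sum>y=1..m. f (y - 1) + f y + f (y + 1)) = 3 * (\<Sum>y=1..m. f y) - f 1 - f m"
proof -
  have "(\<Sum>y=1..m. f (y - 1) + f y + f (y + 1)) =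
      3 * (\<Sum>y=1..m. f y) + f 0 - f m + f (m + 1) - f 1"
    by (induction m) (auto simp: algebra_simps)
  then show ?thesis using assms by simp
qed

text \<open>
  The tridiagonal matrix of ones is symmetric. Functions on \<open>{1..m}\<close> are extended by zero to the
  rows \<open>0\<close> and \<open>m + 1\<close>.
\<close>

lemma neighbours_self_adjoint:
  fixes f g :: "nat \<Rightarrow> real"
  assumes "f 0 = 0" "f (m + 1) = 0" "g 0 = 0" "g (m + 1) = 0"
  shows "(\<Sum>y=1..m. (f (y - 1) + f y + f (y + 1)) * g y) =
         (\<Sum>y=1..m. f y * (g (y - 1) + g y + g (y + 1)))"
proof -
  have "(\<Sum>y=1..m. (f (y - 1) + f y + f (y + 1)) * g y) =
      (\<Sum>y=1..m. f y * (g (y - 1) + g y + g (y + 1))) +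
      f 0 * g 1 - f m * g (m + 1) + f (m + 1) * g m - f 1 * g 0"
    by (induction m) (auto simp: algebra_simps)
  then show ?thesis using assms by simp
qed

lemma sum_column_Suc:
  fixes g :: "nat \<Rightarrow> real"
  assumes "1 \<le> n" "g 0 = 0" "g (m + 1) = 0"
  shows "(\<Sum>y=1..m. g y * real (entry m (Suc n) y)) =
         (\<Sum>y=1..m. (g (y - 1) + g y + g (y + 1)) * real (entry m n y))"
proof -
  have "(\<Sum>y=1..m. g y * real (entry m (Suc n) y)) =
      (\<Sum>y=1..m. g y * (real (entry m n (y - 1)) + real (entry m n y) + real (entry m n (y + 1))))"
    by (rule sum.cong) (use assms entry_Suc in auto)
  also have "\<dots> = (\<Sum>y=1..m. (g (y - 1) + g y + g (y + 1)) * real (entry m n y))"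
    by (rule neighbours_self_adjoint[symmetric]) (use assms in \<open>auto simp: entry_outside\<close>)
  finally show ?thesis .
qed

text \<open>The odd multiples \<open>(2 j + 1) \<pi> / (m + 1)\<close> of \<open>\<pi> / (m + 1)\<close>; these give the eigenvectors
  symmetric under \<open>y \<mapsto> m + 1 - y\<close>.\<close>

definition angle :: "nat \<Rightarrow> nat \<Rightarrow> real" where
  "angle m j = real (2 * j + 1) * pi / real (m + 1)"

text \<open>The eigenvalue of the eigenvector \<open>y \<mapsto> sin (angle m j * y)\<close>.\<close>

definition eigval :: "nat \<Rightarrow> nat \<Rightarrow> real" where
  "eigval m j = 1 + 2 * cos (angle m j)"

lemma angle_bounds:
  assumes "2 * j < m"
  shows "0 < angle m j" "angle m j < pi"
proof -
  show "0 < angle m j" by (simp add: angle_def)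
  have "real (2 * j + 1) < real (m + 1)" using assms by simp
  then have "real (2 * j + 1) * pi < real (m + 1) * pi" by simp
  then show "angle m j < pi" unfolding angle_def by (simp add: divide_simps mult.commute)
qed

lemma sin_angle_end: "sin (angle m j * real (m + 1)) = 0"
proof -
  have "angle m j * real (m + 1) = real (2 * j + 1) * pi"
    unfolding angle_def by (simp del: of_nat_add of_nat_Suc)
  then show ?thesis using sin_npi[of "2 * j + 1"] by simp
qed

lemma sin_angle_last: "sin (angle m j * real m) = sin (angle m j)"
proof -
  have "angle m j * real (m + 1) = real (2 * j + 1) * pi"
    unfolding angle_def by (simp del: of_nat_add of_nat_Suc)
  then have "angle m j * real m = real (2 * j + 1) * pi - angle m j"
    by (simp add: algebra_simps)
  also have "sin \<dots> = sin (angle m j)"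
    using sin_npi[of "2 * j + 1"] cos_npi[of "2 * j + 1"] by (simp only: sin_diff) simp
  finally show ?thesis .
qed

lemma sin_neighbours:
  assumes "1 \<le> y"
  shows "sin (t * real (y - 1)) + sin (t * real y) + sin (t * real (y + 1)) =
    (1 + 2 * cos t) * sin (t * real y)"
proof -
  have "t * real (y - 1) = t * real y - t" "t * real (y + 1) = t * real y + t"
    using assms by (auto simp: algebra_simps of_nat_diff)
  then show ?thesis by (simp only: sin_diff sin_add) (simp add: algebra_simps)
qed

lemma sum_eigenvector_nonzero:
  assumes "2 * j < m"
  shows "(\<Sum>y=1..m. sin (angle m j * real y)) \<noteq> 0"
proof
  let ?v = "\<lambda>y. sin (angle m j * real y)"
  assume 0: "(\<Sum>y=1..m. ?v y) = 0"
  \<comment> \<open>Summing the eigenvalue equation over all rows leaves only the two boundary values, which agree.\<close>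
  have "(\<Sum>y=1..m. ?v (y - 1) + ?v y + ?v (y + 1)) = (\<Sum>y=1..m. eigval m j * ?v y)"
    by (rule sum.cong) (auto simp only: eigval_def sin_neighbours atLeastAtMost_iff)
  also have "\<dots> = 0" using 0 by (simp flip: sum_distrib_left)
  finally have "3 * (\<Sum>y=1..m. ?v y) - ?v 1 - ?v m = 0"
    using sum_neighbours[of ?v m] sin_angle_end[of m j] by simp
  then have "sin (angle m j) = 0" using 0 sin_angle_last[of m j] by simp
  then show False using angle_bounds[OF assms] sin_gt_zero by fastforce
qed

lemma sum_eigenvector_column:
  assumes "1 \<le> m"
  shows "(\<Sum>y=1..m. sin (angle m j * real y) * real (entry m (1 + n) y)) =
    eigval m j ^ n * (\<Sum>y=1..m. sin (angle m j * real y))"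
proof (induction n)
  case 0
  have "(\<Sum>y=1..m. sin (angle m j * real y) * real (entry m (1 + 0) y)) =
      (\<Sum>y=1..m. sin (angle m j * real y))"
    by (rule sum.cong) (use entry_first_column[of _ m] in auto)
  then show ?case by simp
next
  case (Suc n)
  let ?v = "\<lambda>y. sin (angle m j * real y)"
  have "(\<Sum>y=1..m. ?v y * real (entry m (Suc (1 + n)) y)) =
      (\<Sum>y=1..m. (?v (y - 1) + ?v y + ?v (y + 1)) * real (entry m (1 + n) y))"
    by (rule sum_column_Suc) (use sin_angle_end[of m j] in auto)
  also have "\<dots> = (\<Sum>y=1..m. eigval m j * (?v y * real (entry m (1 + n) y)))"
    by (rule sum.cong) (auto simp only: eigval_def sin_neighbours atLeastAtMost_iff mult.assoc)
  also have "\<dots> = eigval m j * (eigval m j ^ n * (\<Sum>y=1..m. ?v y))"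
    using Suc by (simp flip: sum_distrib_left)
  finally show ?case by simp
qed

lemma inj_on_eigval:
  assumes "2 * k \<le> m + 1"
  shows "inj_on (eigval m) {..<k}"
proof (rule inj_onI)
  fix i j assume "i \<in> {..<k}" "j \<in> {..<k}" and e: "eigval m i = eigval m j"
  then have "2 * i < m" "2 * j < m" using assms by auto
  then have "angle m i = angle m j"
    using e cos_inj_pi[of "angle m i" "angle m j"] angle_bounds[of i m] angle_bounds[of j m]
    by (simp add: eigval_def)
  then show "i = j" by (simp add: angle_def)
qed

lemma eigval_nonzero:
  assumes "2 * j < m"
  shows "eigval m j \<noteq> 0"
proof
  assume "eigval m j = 0"
  then have "cos (angle m j) = cos (2 * pi / 3)"
    by (simp add: eigval_def cos_120)
  then have "angle m j = 2 * pi / 3"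
    using cos_inj_pi[of "angle m j" "2 * pi / 3"] angle_bounds[OF assms] by simp
  then have "3 * real (2 * j + 1) = 2 * real (m + 1)"
    by (simp add: angle_def divide_simps del: of_nat_add of_nat_Suc of_nat_mult)
  then have "3 * (2 * j + 1) = 2 * (m + 1)" by linarith
  \<comment> \<open>The left-hand side is odd.\<close>
  then show False by presburger
qed

section \<open>Annihilating polynomials\<close>

text \<open>
  \<open>P\<close> annihilates the table if \<open>P(A)\<close> maps the first column to zero, with \<open>A\<close> the
  tridiagonal matrix of ones. Only the starting index \<open>1\<close> is required; see \<open>annihilates_all\<close>.
\<close>

definition annihilates :: "nat \<Rightarrow> real poly \<Rightarrow> bool" where
  "annihilates m P \<longleftrightarrow> (\<forall>y\<in>{1..m}. shift_eval P (\<lambda>n. real (entry m n y)) 1 = 0)"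

lemma annihilates_imp_root:
  assumes "annihilates m P" "2 * j < m"
  shows "poly P (eigval m j) = 0"
proof -
  let ?v = "\<lambda>y. sin (angle m j * real y)"
  have "0 = (\<Sum>y=1..m. ?v y * shift_eval P (\<lambda>n. real (entry m n y)) 1)"
    using assms(1) by (simp add: annihilates_def)
  also have "\<dots> = shift_eval P (\<lambda>n. \<Sum>y=1..m. ?v y * real (entry m n y)) 1"
    by (rule shift_eval_sum[symmetric])
  also have "\<dots> = (\<Sum>i\<le>degree P. coeff P i * eigval m j ^ i) * (\<Sum>y=1..m. ?v y)"
    using assms(2) sum_eigenvector_column[of m j]
    by (simp add: shift_eval_def sum_distrib_right mult.assoc)
  finally show ?thesis using sum_eigenvector_nonzero[OF assms(2)] by (simp add: poly_altdef)
qed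

lemma poly_eq_0_if_eigval_roots:
  assumes "2 * k \<le> m + 1" "\<And>j. j < k \<Longrightarrow> poly P (eigval m j) = 0" "degree P < k"
  shows "P = 0"
proof (rule ccontr)
  assume "P \<noteq> 0"
  have "k = card (eigval m ` {..<k})"
    by (simp add: card_image[OF inj_on_eigval[OF assms(1)]])
  also have "\<dots> \<le> card {x. poly P x = 0}"
    by (rule card_mono) (use assms \<open>P \<noteq> 0\<close> poly_roots_finite in auto)
  also have "\<dots> \<le> degree P" by (rule card_poly_roots_bound) fact
  finally show False using assms by simp
qed

lemma dvd_if_eigval_roots:
  assumes "2 * k \<le> m + 1" "degree M = k" "M \<noteq> 0"
    and M: "\<And>j. j < k \<Longrightarrow> poly M (eigval m j) = 0"
    and P: "\<And>j. j < k \<Longrightarrow> poly P (eigval m j) = 0"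
  shows "M dvd P"
proof -
  have "poly (P mod M) (eigval m j) = 0" if "j < k" for j
  proof -
    have "poly (P div M * M + P mod M) (eigval m j) = 0" using P[OF that] by simp
    then show ?thesis using M[OF that] by (simp only: poly_add poly_mult mult_zero_right add_0)
  qed
  moreover have "P mod M = 0 \<or> degree (P mod M) < k"
    using degree_mod_less[OF assms(3), of P] assms(2) by simp
  ultimately have "P mod M = 0" using poly_eq_0_if_eigval_roots[OF assms(1)] by blast
  then show ?thesis by (simp only: dvd_eq_mod_eq_0)
qed

lemma coeff_0_nonzero_if_eigval_roots:
  assumes "2 * k \<le> m + 1" "degree P = k" "P \<noteq> 0"
    and P: "\<And>j. j < k \<Longrightarrow> poly P (eigval m j) = 0"
  shows "coeff P 0 \<noteq> 0"
proof
  \<comment> \<open>Otherwise \<open>0\<close> is a further root of \<open>P\<close>, besides the \<open>k\<close> nonzero eigenvalues.\<close>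
  assume "coeff P 0 = 0"
  then obtain Q where Q: "P = pCons 0 Q" by (cases P) simp
  then have "Q \<noteq> 0" using assms by auto
  have "poly Q (eigval m j) = 0" if "j < k" for j
    using P[OF that] Q eigval_nonzero[of j m] that assms(1) by simp
  moreover have "degree Q < k" using Q \<open>Q \<noteq> 0\<close> assms(2) by auto
  ultimately show False using poly_eq_0_if_eigval_roots[OF assms(1)] \<open>Q \<noteq> 0\<close> by blast
qed

lemma annihilates_all:
  assumes "annihilates m P" "1 \<le> n" "y \<in> {1..m}"
  shows "shift_eval P (\<lambda>n. real (entry m n y)) n = 0"
  using assms(2,3)
proof (induction n arbitrary: y rule: nat_induct_at_least)
  case base
  then show ?case using assms(1) by (simp add: annihilates_def)
next
  case (Suc n)
  let ?L = "\<lambda>z. shift_eval P (\<lambda>n. real (entry m n z)) n"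
  have 0: "?L z = 0" if "z \<le> m + 1" for z
  proof (cases "z = 0 \<or> z = m + 1")
    case True
    then show ?thesis by (auto simp: shift_eval_def entry_outside)
  next
    case False
    then show ?thesis using that Suc.IH by auto
  qed
  have "shift_eval P (\<lambda>n. real (entry m n y)) (Suc n) = ?L (y - 1) + ?L y + ?L (y + 1)"
    using Suc.prems Suc.hyps by (simp add: shift_eval_def entry_Suc sum.distrib algebra_simps)
  moreover have "y - 1 \<le> m + 1" "y \<le> m + 1" "y + 1 \<le> m + 1" using Suc.prems by auto
  ultimately show ?case by (simp only: 0 add_0)
qed

text \<open>It suffices to check the rows \<open>1, \<dots>, k\<close> of the upper half.\<close>

lemma annihilates_reduced:
  assumes "m \<le> 2 * k" "k \<le> m"
  shows "annihilates m P \<longleftrightarrow> (\<forall>i<k. shift_eval P (\<lambda>n. real (entry m n (i + 1))) 1 = 0)"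
proof
  assume "annihilates m P"
  then show "\<forall>i<k. shift_eval P (\<lambda>n. real (entry m n (i + 1))) 1 = 0"
    using assms by (auto simp: annihilates_def)
next
  assume *: "\<forall>i<k. shift_eval P (\<lambda>n. real (entry m n (i + 1))) 1 = 0"
  have upper: "shift_eval P (\<lambda>n. real (entry m n y)) 1 = 0" if "1 \<le> y" "y \<le> k" for y
    using *[rule_format, of "y - 1"] that by simp
  show "annihilates m P"
    unfolding annihilates_def
  proof
    fix y assume y: "y \<in> {1..m}"
    show "shift_eval P (\<lambda>n. real (entry m n y)) 1 = 0"
    proof (cases "y \<le> k")
      case True
      then show ?thesis using upper y by simp
    next
      case False
      have "shift_eval P (\<lambda>n. real (entry m n y)) 1 =
          shift_eval P (\<lambda>n. real (entry m n (m + 1 - y))) 1"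
        using y entry_symmetric[of _ y m] by (simp add: shift_eval_def)
      then show ?thesis using upper[of "m + 1 - y"] y False assms by simp
    qed
  qed
qed

lemma entries_rec_iff: "entries_rec m \<beta> \<longleftrightarrow> annihilates m (rec_poly \<beta>)"
  using annihilates_all[of m "rec_poly \<beta>"]
  by (auto simp: entries_rec_def satisfies_rec_iff annihilates_def)

section \<open>Column sums\<close>

text \<open>
  By symmetry of the tridiagonal matrix, factors of it can be moved from one column to the other, so the
  inner product of columns \<open>p\<close> and \<open>q + 1\<close> is that of columns \<open>p + q\<close> and \<open>1\<close>.
\<close>

lemma column_sum_inner:
  assumes "1 \<le> p"
  shows "(\<Sum>y=1..m. real (entry m p y) * real (entry m (1 + q) y)) = real (column_sum m (p + q))"
  using assms
proof (induction q arbitrary: p)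
  case 0
  have "(\<Sum>y=1..m. real (entry m p y) * real (entry m (1 + 0) y)) = (\<Sum>y=1..m. real (entry m p y))"
    by (rule sum.cong) (use entry_first_column[of _ m] in auto)
  then show ?case by (simp add: column_sum_def)
next
  case (Suc q)
  have "(\<Sum>y=1..m. real (entry m p y) * real (entry m (Suc (1 + q)) y)) =
      (\<Sum>y=1..m. (real (entry m p (y - 1)) + real (entry m p y) + real (entry m p (y + 1))) *
         real (entry m (1 + q) y))"
    by (rule sum_column_Suc) (auto simp: entry_outside)
  also have "\<dots> = (\<Sum>y=1..m. real (entry m (Suc p) y) * real (entry m (1 + q) y))"
    by (rule sum.cong) (use Suc.prems entry_Suc in auto)
  also have "\<dots> = real (column_sum m (Suc p + q))" by (rule Suc.IH) simp
  finally show ?case by simp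
qed

lemma sums_annihilated_imp_annihilates:
  assumes "\<And>n. 1 \<le> n \<Longrightarrow> shift_eval P (\<lambda>n. real (column_sum m n)) n = 0"
  shows "annihilates m P"
proof -
  let ?u = "\<lambda>y. shift_eval P (\<lambda>n. real (entry m n y)) 1"
  have orth: "(\<Sum>y=1..m. real (entry m p y) * ?u y) = 0" if "1 \<le> p" for p
  proof -
    have "(\<Sum>y=1..m. real (entry m p y) * ?u y) =
        shift_eval P (\<lambda>n. \<Sum>y=1..m. real (entry m p y) * real (entry m n y)) 1"
      by (rule shift_eval_sum[symmetric])
    also have "\<dots> = shift_eval P (\<lambda>n. real (column_sum m n)) p"
      using column_sum_inner[OF that, of m] by (simp add: shift_eval_def)
    finally show ?thesis using assms that by simp
  qed
  \<comment> \<open>\<open>?u\<close> is itself a linear combination of columns.\<close>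
  have "(\<Sum>y=1..m. ?u y * ?u y) =
      shift_eval P (\<lambda>n. \<Sum>y=1..m. ?u y * real (entry m n y)) 1"
    by (rule shift_eval_sum[symmetric])
  also have "\<dots> = 0"
    unfolding shift_eval_def[of P "\<lambda>n. \<Sum>y=1..m. ?u y * real (entry m n y)"]
    using orth[of "1 + _"] by (simp add: mult.commute[of "?u _"] del: One_nat_def)
  finally have "\<forall>y\<in>{1..m}. ?u y * ?u y = 0"
    by (subst (asm) sum_nonneg_eq_0_iff) auto
  then show ?thesis by (simp add: annihilates_def)
qed

lemma entries_rec_imp_sums_rec:
  assumes "entries_rec m \<beta>"
  shows "sums_rec m \<beta>"
proof -
  have "shift_eval (rec_poly \<beta>) (\<lambda>n. real (column_sum m n)) n =
      (\<Sum>y=1..m. shift_eval (rec_poly \<beta>) (\<lambda>n. real (entry m n y)) n)" for n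
    using shift_eval_sum[where P = "rec_poly \<beta>" and S = "{1..m}" and w = "\<lambda>_. 1" and
        f = "\<lambda>n y. real (entry m n y)"]
    by (simp add: column_sum_def)
  then show ?thesis
    using assms by (simp add: sums_rec_def satisfies_rec_iff entries_rec_def)
qed

lemma sums_rec_iff_entries_rec: "sums_rec m \<beta> \<longleftrightarrow> entries_rec m \<beta>"
  using entries_rec_imp_sums_rec sums_annihilated_imp_annihilates[of "rec_poly \<beta>" m]
  by (auto simp: entries_rec_iff sums_rec_def satisfies_rec_iff)

section \<open>The reduced linear system\<close>

lemma ex1_solution_if_trivial_kernel:
  fixes A :: "real mat"
  assumes A: "A \<in> carrier_mat n n" and b: "b \<in> carrier_vec n"
    and ker: "\<And>w. w \<in> carrier_vec n \<Longrightarrow> A *\<^sub>v w = 0\<^sub>v n \<Longrightarrow> w = 0\<^sub>v n"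
  shows "\<exists>!x. x \<in> carrier_vec n \<and> A *\<^sub>v x = b"
proof (rule ex_ex1I)
  have "det A \<noteq> 0" using det_0_iff_vec_prod_zero_field[OF A] ker by blast
  let ?x = "adj_mat A *\<^sub>v ((1 / det A) \<cdot>\<^sub>v b)"
  have "A *\<^sub>v ?x = (A * adj_mat A) *\<^sub>v ((1 / det A) \<cdot>\<^sub>v b)"
    using A b adj_mat(1)[OF A] by (intro assoc_mult_mat_vec[symmetric]) auto
  also have "\<dots> = det A \<cdot>\<^sub>v ((1 / det A) \<cdot>\<^sub>v b)"
    using b by (intro eq_vecI)
      (auto simp: adj_mat(2)[OF A] smult_scalar_prod_distrib[of _ n] scalar_prod_left_unit)
  also have "\<dots> = b" using \<open>det A \<noteq> 0\<close> b by (auto simp: smult_smult_assoc)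
  finally show "\<exists>x. x \<in> carrier_vec n \<and> A *\<^sub>v x = b"
    using adj_mat(1)[OF A] b by (intro exI[of _ ?x]) auto
next
  fix x y assume x: "x \<in> carrier_vec n \<and> A *\<^sub>v x = b" and y: "y \<in> carrier_vec n \<and> A *\<^sub>v y = b"
  then have "A *\<^sub>v (x - y) = 0\<^sub>v n"
    using A b by (simp add: mult_minus_distrib_mat_vec)
  then have "x - y = 0\<^sub>v n" using ker x y by simp
  show "x = y"
  proof (rule eq_vecI)
    fix i assume "i < dim_vec y"
    then have "i < n" using y by auto
    then have "(x - y) $ i = 0" unfolding \<open>x - y = 0\<^sub>v n\<close> by simp
    then show "x $ i = y $ i" using \<open>i < dim_vec y\<close> x y by simp
  qed (use x y in auto)
qed

lemma reduced_matrix_carrier: "reduced_matrix m k \<in> carrier_mat (nat \<lceil>real m / 2\<rceil>) k"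
  by (auto simp: reduced_matrix_def mat_of_cols_carrier)

lemma reduced_matrix_mult_index:
  assumes "k = nat \<lceil>real m / 2\<rceil>" "w \<in> carrier_vec k" "i < k"
  shows "(reduced_matrix m k *\<^sub>v w) $ i = shift_eval (vec_poly w) (\<lambda>n. real (entry m n (i + 1))) 1"
proof -
  have "(reduced_matrix m k *\<^sub>v w) $ i = (\<Sum>j<k. real (entry m (1 + j) (i + 1)) * w $ j)"
    using assms reduced_matrix_carrier[of m k]
    by (auto simp: scalar_prod_def lessThan_atLeast0 reduced_matrix_def mat_of_cols_index
        reduced_column_def simp del: upt_Suc intro!: sum.cong)
  also have "\<dots> = (\<Sum>j\<le>k. coeff (vec_poly w) j * real (entry m (1 + j) (i + 1)))"
    using assms(2) by (simp add: coeff_vec_poly mult.commute flip: lessThan_Suc_atMost)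
  also have "\<dots> = shift_eval (vec_poly w) (\<lambda>n. real (entry m n (i + 1))) 1"
    by (rule shift_eval_bound[symmetric], rule degree_le) (use assms(2) in \<open>simp add: coeff_vec_poly\<close>)
  finally show ?thesis .
qed

lemma half_ceiling_bounds:
  assumes "k = nat \<lceil>real m / 2\<rceil>"
  shows "m \<le> 2 * k" "2 * k \<le> m + 1"
proof -
  have "k = (m + 1) div 2"
    using assms by linarith
  then show "m \<le> 2 * k" "2 * k \<le> m + 1" by auto
qed

lemma reduced_kernel_trivial:
  assumes "m \<ge> 1" and k: "k = nat \<lceil>real m / 2\<rceil>" and w: "w \<in> carrier_vec k"
    and "reduced_matrix m k *\<^sub>v w = 0\<^sub>v k"
  shows "w = 0\<^sub>v k"
proof -
  note b = half_ceiling_bounds[OF k]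
  have "annihilates m (vec_poly w)"
    using annihilates_reduced[of m k "vec_poly w"] b assms reduced_matrix_mult_index[OF k w] by simp
  moreover have "degree (vec_poly w) < k"
  proof -
    have "degree (vec_poly w) \<le> k - 1"
      by (rule degree_le) (use w in \<open>auto simp: coeff_vec_poly\<close>)
    then show ?thesis using b assms(1) by linarith
  qed
  ultimately have "vec_poly w = 0"
    using b by (intro poly_eq_0_if_eigval_roots[OF b(2)] annihilates_imp_root) auto
  show ?thesis
  proof (rule eq_vecI)
    fix i assume "i < dim_vec (0\<^sub>v k :: real vec)"
    then show "w $ i = 0\<^sub>v k $ i"
      using arg_cong[OF \<open>vec_poly w = 0\<close>, of "\<lambda>P. coeff P i"] w by (simp add: coeff_vec_poly)
  qed (use w in simp)
qed

lemma reduced_solution_iff: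
  assumes "m \<ge> 1" and k: "k = nat \<lceil>real m / 2\<rceil>" and \<alpha>: "\<alpha> \<in> carrier_vec k"
  shows "reduced_matrix m k *\<^sub>v \<alpha> = reduced_column m (k + 1) \<longleftrightarrow> annihilates m (rec_poly \<alpha>)"
proof -
  note b = half_ceiling_bounds[OF k]
  have eq: "shift_eval (rec_poly \<alpha>) a n = a (n + k) - shift_eval (vec_poly \<alpha>) a n" for a n
  proof -
    have "shift_eval (vec_poly \<alpha>) a n = (\<Sum>j\<le>k. coeff (vec_poly \<alpha>) j * a (n + j))"
      by (rule shift_eval_bound, rule degree_le) (use \<alpha> in \<open>simp add: coeff_vec_poly\<close>)
    also have "\<dots> = (\<Sum>j<k. \<alpha> $ j * a (n + j))"
      using \<alpha> by (simp add: coeff_vec_poly flip: lessThan_Suc_atMost)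
    finally show ?thesis using \<alpha> by (simp add: rec_defect_def flip: rec_defect_eq_shift_eval)
  qed
  have "annihilates m (rec_poly \<alpha>) \<longleftrightarrow>
      (\<forall>i<k. (reduced_matrix m k *\<^sub>v \<alpha>) $ i = reduced_column m (k + 1) $ i)"
    using annihilates_reduced[of m k "rec_poly \<alpha>"] b assms(1) reduced_matrix_mult_index[OF k \<alpha>]
    by (auto simp: eq reduced_column_def k[symmetric])
  also have "\<dots> \<longleftrightarrow> reduced_matrix m k *\<^sub>v \<alpha> = reduced_column m (k + 1)"
  proof
    assume *: "\<forall>i<k. (reduced_matrix m k *\<^sub>v \<alpha>) $ i = reduced_column m (k + 1) $ i"
    show "reduced_matrix m k *\<^sub>v \<alpha> = reduced_column m (k + 1)"
      by (rule eq_vecI) (use * reduced_matrix_carrier[of m k] k in \<open>auto simp: reduced_column_def\<close>)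
  qed simp
  finally show ?thesis by simp
qed

theorem theorem2p8:
  fixes m k :: nat
  assumes "m \<ge> 1" and "k = nat \<lceil>real m / 2\<rceil>"
  shows "(\<exists>!\<alpha>. \<alpha> \<in> carrier_vec k \<and>
             reduced_matrix m k *\<^sub>v \<alpha> = reduced_column m (k + 1)) \<and>
    (\<forall>\<alpha>. \<alpha> \<in> carrier_vec k \<and>
         reduced_matrix m k *\<^sub>v \<alpha> = reduced_column m (k + 1) \<longrightarrow>
       (\<forall>i\<in>{1..m}. \<forall>n\<ge>1.
          real (entry m (n + k) i) = (\<Sum>j<k. \<alpha> $ j * real (entry m (n + j) i))) \<and>
       (\<forall>n\<ge>1.
          real (column_sum m (n + k)) = (\<Sum>j<k. \<alpha> $ j * real (column_sum m (n + j)))) \<and>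
       has_degree \<alpha> k \<and>
       (\<forall>\<beta> d. entries_rec m \<beta> \<and> has_degree \<beta> d \<longrightarrow> k \<le> d) \<and>
       (\<forall>\<beta> d. sums_rec m \<beta> \<and> has_degree \<beta> d \<longrightarrow> k \<le> d) \<and>
       (\<forall>\<beta>. entries_rec m \<beta> \<longrightarrow> derived_from \<alpha> \<beta>) \<and>
       (\<forall>\<beta>. sums_rec m \<beta> \<longrightarrow> derived_from \<alpha> \<beta>))"
proof (intro conjI allI impI)
  note m = assms(1) and k = assms(2)
  note b = half_ceiling_bounds[OF k]
  show "\<exists>!\<alpha>. \<alpha> \<in> carrier_vec k \<and> reduced_matrix m k *\<^sub>v \<alpha> = reduced_column m (k + 1)"
    by (rule ex1_solution_if_trivial_kernel)
      (use reduced_matrix_carrier[of m k] reduced_kernel_trivial[OF m k] k in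
        \<open>auto simp: reduced_column_def\<close>)
  fix \<alpha> assume \<alpha>: "\<alpha> \<in> carrier_vec k \<and> reduced_matrix m k *\<^sub>v \<alpha> = reduced_column m (k + 1)"
  then have dim: "dim_vec \<alpha> = k" and ann: "annihilates m (rec_poly \<alpha>)"
    using reduced_solution_iff[OF m k] by auto
  have entries: "entries_rec m \<alpha>" using ann by (simp add: entries_rec_iff)
  then show "\<forall>i\<in>{1..m}. \<forall>n\<ge>1.
      real (entry m (n + k) i) = (\<Sum>j<k. \<alpha> $ j * real (entry m (n + j) i))"
    by (simp add: entries_rec_def satisfies_rec_def dim)
  show "real (column_sum m (n + k)) = (\<Sum>j<k. \<alpha> $ j * real (column_sum m (n + j)))" if "1 \<le> n" for n
    using entries_rec_imp_sums_rec[OF entries] that by (simp add: sums_rec_def satisfies_rec_def dim)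
  have roots: "poly P (eigval m j) = 0" if "annihilates m P" "j < k" for P j
    using annihilates_imp_root[OF that(1)] that(2) b(2) by simp
  have deg: "degree (rec_poly \<alpha>) = k" by (simp add: degree_rec_poly dim)
  show "has_degree \<alpha> k"
    using coeff_0_nonzero_if_eigval_roots[OF b(2) deg rec_poly_nonzero roots[OF ann]] m b(1)
    by (simp add: has_degree_def dim coeff_rec_poly split: if_splits)
  have min: "k \<le> d" if "entries_rec m \<beta>" "has_degree \<beta> d" for \<beta> d
  proof (rule ccontr)
    assume "\<not> k \<le> d"
    then have "degree (rec_poly \<beta>) < k" using that by (simp add: degree_rec_poly has_degree_def)
    then show False
      using poly_eq_0_if_eigval_roots[OF b(2) roots] that rec_poly_nonzero
      by (auto simp: entries_rec_iff)
  qed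
  then show "k \<le> d" if "entries_rec m \<beta> \<and> has_degree \<beta> d" for \<beta> d using that by blast
  show "k \<le> d" if "sums_rec m \<beta> \<and> has_degree \<beta> d" for \<beta> d
    using that min[of \<beta> d] by (simp add: sums_rec_iff_entries_rec)
  show der: "derived_from \<alpha> \<beta>" if "entries_rec m \<beta>" for \<beta>
    using dvd_if_eigval_roots[OF b(2) deg rec_poly_nonzero roots[OF ann] roots] that
    by (intro dvd_imp_derived_from) (simp add: entries_rec_iff)
  show "derived_from \<alpha> \<beta>" if "sums_rec m \<beta>" for \<beta>
    using der that by (simp add: sums_rec_iff_entries_rec)
qed

end
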